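(* For every even integer $n\geq 6$, $\Pi^{bichrom}(n)\leq \left\lceil \frac{n}{5}\right\rceil+1$. That is, there exist a simple polygon $P$ and a set $S$ in general position in $P$ of $n/2$ red and $n/2$ blue points such that for every red point $r\in S$ and blue point $b\in S$ there is a geodesic disk through $r$ and $b$ containing at most $\left\lceil \frac{n}{5}\right\rceil+1$ points of $S$.
   Context: $P$ is a simple polygon (a closed region). For $a,b\in P$, $g(a,b)$ denotes the shortest (geodesic) path from $a$ to $b$ inside $P$ and $|g(a,b)|$ its length. A geodesic disk with center $c$ and radius $r$ is $D(c,r)=\{x\in P:|g(c,x)|\le r\}$; it is "through" some points if those points lie on its boundary (distance exactly $r$ from $c$), and contains a point if the point belongs to it. General position of $S$: no three points of $S$ are geodesically collinear (one on the geodesic path between the other two), no four points among $S$ and the vertices of $P$ lie on the boundary of a common geodesic disk, there are no $x,y\in S$ and reflex vertex $p$ of $P$ with $y\in g(x,p)$, and no geodesic bisector of two points of $S$ passes through a vertex of $P$. $\Pi^{bichrom}(n)$ is the largest integer such that for every simple polygon $P$ and every such set $S$ of $n/2$ red and $n/2$ blue points, there exist a red point $r$ and a blue point $b$ such that every geodesic disk through them contains at least $\Pi^{bichrom}(n)$ points of $S$. *)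

theory Defs
  imports "HOL-Analysis.Analysis"
begin

fun polypath :: "complex list \<Rightarrow> real \<Rightarrow> complex" where
  "polypath [] = linepath 0 0"
| "polypath [a] = linepath a a"
| "polypath [a, b] = linepath a b"
| "polypath (a # b # c # xs) = linepath a b +++ polypath (b # c # xs)"

definition boundary_curve :: "complex list \<Rightarrow> real \<Rightarrow> complex" where
  "boundary_curve vs = polypath (vs @ [hd vs])"

definition simple_polygon :: "complex set \<Rightarrow> complex list \<Rightarrow> bool" where
  "simple_polygon P vs \<longleftrightarrow> length vs \<ge> 3 \<and> distinct vs \<and>
     simple_path (boundary_curve vs) \<and>
     P = path_image (boundary_curve vs) \<union> inside (path_image (boundary_curve vs))"

definition chain_in :: "complex set \<Rightarrow> complex list \<Rightarrow> complex \<Rightarrow> complex \<Rightarrow> bool" where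
  "chain_in P xs a b \<longleftrightarrow> xs \<noteq> [] \<and> hd xs = a \<and> last xs = b \<and>
     (\<forall>i < length xs - 1. closed_segment (xs ! i) (xs ! Suc i) \<subseteq> P)"

definition chain_len :: "complex list \<Rightarrow> real" where
  "chain_len xs = (\<Sum>i < length xs - 1. dist (xs ! i) (xs ! Suc i))"

definition gdist :: "complex set \<Rightarrow> complex \<Rightarrow> complex \<Rightarrow> real" where
  "gdist P a b = Inf {chain_len xs | xs. chain_in P xs a b}"

definition gpath :: "complex set \<Rightarrow> complex \<Rightarrow> complex \<Rightarrow> complex set" where
  "gpath P a b = {z. \<exists>xs. chain_in P xs a b \<and> chain_len xs = gdist P a b \<and>
      (z \<in> set xs \<or> (\<exists>i < length xs - 1. z \<in> closed_segment (xs ! i) (xs ! Suc i)))}"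

definition gdisk :: "complex set \<Rightarrow> complex \<Rightarrow> real \<Rightarrow> complex set" where
  "gdisk P c r = {x \<in> P. gdist P c x \<le> r}"

text \<open>Reflex vertex: a vertex at which P is locally non-convex (interior angle > pi).\<close>
definition reflex_vertex :: "complex set \<Rightarrow> complex list \<Rightarrow> complex \<Rightarrow> bool" where
  "reflex_vertex P vs p \<longleftrightarrow> p \<in> set vs \<and> (\<forall>e>0. \<not> convex (P \<inter> ball p e))"

definition general_position :: "complex set \<Rightarrow> complex list \<Rightarrow> complex set \<Rightarrow> bool" where
  "general_position P vs S \<longleftrightarrow>
     (\<forall>x\<in>S. \<forall>y\<in>S. \<forall>z\<in>S. x \<noteq> y \<and> y \<noteq> z \<and> x \<noteq> z \<longrightarrow> y \<notin> gpath P x z) \<and>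
     (\<not> (\<exists>c\<in>P. \<exists>r. \<exists>Q. Q \<subseteq> S \<union> set vs \<and> card Q = 4 \<and> (\<forall>q\<in>Q. gdist P c q = r))) \<and>
     (\<forall>x\<in>S. \<forall>y\<in>S. \<forall>p. x \<noteq> y \<and> reflex_vertex P vs p \<longrightarrow> y \<notin> gpath P x p) \<and>
     (\<forall>x\<in>S. \<forall>y\<in>S. \<forall>v\<in>set vs. x \<noteq> y \<longrightarrow> gdist P x v \<noteq> gdist P y v)"

end

theory Submission
  imports Defs
begin

text \<open>
  In a convex polygon geodesic disks are Euclidean disks, so it suffices to find a planar
  configuration and put a large triangle around it. With $k = \lceil n/5 \rceil$, place $k$ red
  points on the \<open>y\<close>-axis above the unit circle, at most $k$ below it, and the rest of the red points,
  at most $k/2$ many, at the origin; place $k$ blue points on the unit circle near $1$, at most $k$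
  near $-1$, and the remaining at most $k/2$ on the \<open>x\<close>-axis, close to the origin. The disks are:

  \<^item> for a red point on a spoke of the \<open>y\<close>-axis and a blue point on the circle, the disk through both
    that is tangent to the \<open>y\<close>-axis: it contains no other red point, and blue points of one cluster;

  \<^item> for a red point on a spoke and a blue point on the \<open>x\<close>-axis, the disk tangent to the \<open>x\<close>-axis: it
    contains no other blue point, and red points of one spoke;

  \<^item> for a red point at the origin, the disk having the segment to the blue point as a diameter: it
    meets the unit circle only in that point, so it contains at most $k$ further points.

  That these closed disks contain few points survives small perturbations of the configuration, and
  the perturbations violating general position form a null set.
\<close>

section \<open>Convex polygons\<close>

lemma chain_len_Cons:
  "xs \<noteq> [] \<Longrightarrow> chain_len (x # xs) = dist x (hd xs) + chain_len xs"
proof -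
  assume "xs \<noteq> []"
  then obtain m where m: "length xs = Suc m" by (cases xs) auto
  have "chain_len (x # xs) = (\<Sum>i<Suc m. dist ((x # xs) ! i) (xs ! i))"
    by (simp add: chain_len_def m)
  also have "\<dots> = dist x (xs ! 0) + (\<Sum>i<m. dist (xs ! i) (xs ! Suc i))"
    by (simp add: sum.lessThan_Suc_shift del: sum.lessThan_Suc)
  finally show ?thesis
    using \<open>xs \<noteq> []\<close> by (simp add: chain_len_def m hd_conv_nth)
qed

lemma chain_len_ge_dist: "xs \<noteq> [] \<Longrightarrow> dist (hd xs) (last xs) \<le> chain_len xs"
proof (induction xs rule: list_nonempty_induct)
  case (single x)
  then show ?case by (simp add: chain_len_def)
next
  case (cons x xs)
  then show ?case
    using dist_triangle[of x "last xs" "hd xs"] by (simp add: chain_len_Cons)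
qed

text \<open>Cutting the chain at z and applying the triangle inequality to both pieces gives the
  bound. The condition on z is the one in \<open>gpath\<close>, so for a chain of length
  \<open>dist a b\<close> the triangle inequality through z becomes an equality.\<close>

lemma chain_len_ge_via:
  assumes "xs \<noteq> []"
    and "z \<in> set xs \<or> (\<exists>i < length xs - 1. z \<in> closed_segment (xs ! i) (xs ! Suc i))"
  shows "dist (hd xs) z + dist z (last xs) \<le> chain_len xs"
  using assms
proof (induction xs rule: list_nonempty_induct)
  case (single x)
  then show ?case by (simp add: chain_len_def)
next
  case (cons x xs)
  note len = chain_len_Cons[OF \<open>xs \<noteq> []\<close>, of x]
  consider "z = x" | "z \<in> closed_segment x (hd xs)"
    | "z \<in> set xs \<or> (\<exists>i < length xs - 1. z \<in> closed_segment (xs ! i) (xs ! Suc i))"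
  proof -
    have "z \<in> closed_segment x (hd xs) \<or>
        (\<exists>i < length xs - 1. z \<in> closed_segment (xs ! i) (xs ! Suc i))"
      if i: "i < length (x # xs) - 1" "z \<in> closed_segment ((x # xs) ! i) ((x # xs) ! Suc i)" for i
    proof (cases i)
      case 0
      then show ?thesis using i \<open>xs \<noteq> []\<close> by (simp add: hd_conv_nth)
    next
      case (Suc j)
      then show ?thesis using i by (intro disjI2 exI[of _ j]) auto
    qed
    then show thesis using cons.prems that by (auto 4 3)
  qed
  then show ?case
  proof cases
    case 1
    then show ?thesis
      using chain_len_ge_dist[of "x # xs"] by simp
  next
    case 2
    then have "dist x (hd xs) = dist x z + dist z (hd xs)"
      by (simp add: between_mem_segment[symmetric] between)
    then show ?thesis
      using chain_len_ge_dist[OF \<open>xs \<noteq> []\<close>] dist_triangle[of z "last xs" "hd xs"] len \<open>xs \<noteq> []\<close>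
      by simp
  next
    case 3
    then show ?thesis
      using cons.IH dist_triangle[of x z "hd xs"] len \<open>xs \<noteq> []\<close> by simp
  qed
qed

text \<open>By convexity the single segment is an admissible chain, and it attains the lower bound
  that the triangle inequality gives for every chain; the infimum is thus a minimum.\<close>

lemma gdist_convex:
  assumes "convex P" "a \<in> P" "b \<in> P"
  shows "gdist P a b = dist a b"
  unfolding gdist_def
proof (rule cInf_eq_minimum)
  have "chain_in P [a, b] a b"
    using assms by (simp add: chain_in_def closed_segment_subset)
  moreover have "chain_len [a, b] = dist a b"
    by (simp add: chain_len_def)
  ultimately show "dist a b \<in> {chain_len xs |xs. chain_in P xs a b}" by (intro CollectI exI[of _ "[a, b]"]) simp
next
  fix l assume "l \<in> {chain_len xs |xs. chain_in P xs a b}"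
  then show "dist a b \<le> l"
    using chain_len_ge_dist by (auto simp: chain_in_def)
qed

text \<open>Equality in the triangle inequality puts z between a and b. This turns the geodesic
  collinearity in \<open>general_position\<close> into ordinary collinearity.\<close>

lemma gpath_convex_subset:
  assumes "convex P" "a \<in> P" "b \<in> P"
  shows "gpath P a b \<subseteq> closed_segment a b"
proof
  fix z assume "z \<in> gpath P a b"
  then obtain xs where xs: "chain_in P xs a b" "chain_len xs = dist a b"
    and "z \<in> set xs \<or> (\<exists>i < length xs - 1. z \<in> closed_segment (xs ! i) (xs ! Suc i))"
    by (auto simp: gpath_def gdist_convex[OF assms])
  then have "dist a z + dist z b \<le> dist a b"
    using chain_len_ge_via[of xs z] by (auto simp: chain_in_def)
  then have "between (a, b) z"
    using dist_triangle[of a b z] by (simp add: between)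
  then show "z \<in> closed_segment a b" by (simp add: between_mem_segment)
qed

section \<open>Triangles as simple polygons\<close>

text \<open>Two closed sides of a nondegenerate triangle share only their common vertex: the sides
  bc and ca form an arc, which ab closes to a loop.\<close>

lemma simple_path_triangle:
  assumes "\<not> collinear {a, b, c::complex}"
  shows "simple_path (linepath a b +++ linepath b c +++ linepath c a)"
proof -
  have ne: "a \<noteq> b" "b \<noteq> c" "c \<noteq> a"
    using assms by (auto simp: insert_commute)
  have meet: "closed_segment x y \<inter> closed_segment y z \<subseteq> {y}"
    if "\<not> collinear {x, y, z}" for x y z :: complex
    using that Int_closed_segment[of y x z] by auto
  have bc: "arc (linepath b c +++ linepath c a)"
    using ne meet[of b c a] assms by (intro arc_join) (auto simp: insert_commute)
  show ?thesis
    using bc ne meet[of a b c] meet[of c a b] assms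
    by (intro simple_path_join_loop) (auto simp: path_image_join insert_commute)
qed

lemma simple_polygon_triangle:
  assumes "\<not> collinear {a, b, c}"
  shows "simple_polygon (convex hull {a, b, c}) [a, b, c]"
proof -
  have ne: "a \<noteq> b" "b \<noteq> c" "c \<noteq> a"
    using assms by (auto simp: insert_commute)
  have curve: "boundary_curve [a, b, c] = linepath a b +++ linepath b c +++ linepath c a"
    by (simp add: boundary_curve_def)
  have img: "path_image (boundary_curve [a, b, c]) =
      closed_segment a b \<union> closed_segment b c \<union> closed_segment c a"
    unfolding curve by (auto simp: path_image_join)
  have "closed (convex hull {a, b, c})"
    by (intro compact_imp_closed finite_imp_compact_convex_hull) auto
  then have "convex hull {a, b, c} = frontier (convex hull {a, b, c}) \<union> interior (convex hull {a, b, c})"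
    using interior_subset by (auto simp: frontier_def)
  then show ?thesis
    using simple_path_triangle[OF assms] ne
    by (simp add: simple_polygon_def img inside_of_triangle frontier_of_triangle flip: curve)
qed

section \<open>Generic perturbations\<close>

text \<open>Euclidean counterpart of \<open>general_position\<close>, free of P, with F the points
  together with the vertices V. Forbidding collinear triples also among vertices lets any three old
  points determine one circle. The bisector clause skips V, because a corner of the triangle
  \<open>tri\<close> used later is equidistant from the other two.\<close>

definition generic :: "complex set \<Rightarrow> complex set \<Rightarrow> bool" where
  "generic V F \<longleftrightarrow>
     (\<forall>x\<in>F. \<forall>y\<in>F. \<forall>z\<in>F. x \<noteq> y \<and> y \<noteq> z \<and> x \<noteq> z \<longrightarrow> \<not> collinear {x, y, z}) \<and>
     (\<forall>c Q. Q \<subseteq> F \<and> card Q = 4 \<longrightarrow> \<not> (\<exists>r. \<forall>q\<in>Q. dist c q = r)) \<and>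
     (\<forall>v\<in>V. \<forall>x\<in>F - V. \<forall>y\<in>F - V. x \<noteq> y \<longrightarrow> dist v x \<noteq> dist v y)"

text \<open>Differences of points of T are orthogonal to w = c - d, so if w were nonzero they would
  all be multiples of w rotated by a quarter turn, and T would lie on a line.\<close>

lemma circumcentre_unique:
  fixes c d :: complex
  assumes "\<not> collinear T"
    and "\<And>x y. x \<in> T \<Longrightarrow> y \<in> T \<Longrightarrow> dist c x = dist c y"
    and "\<And>x y. x \<in> T \<Longrightarrow> y \<in> T \<Longrightarrow> dist d x = dist d y"
  shows "c = d"
proof (rule ccontr)
  assume "c \<noteq> d"
  define w where "w = c - d"
  have w: "w \<bullet> w \<noteq> 0" using \<open>c \<noteq> d\<close> by (simp add: w_def)
  have "\<exists>s. x - y = s *\<^sub>R (\<i> * w)" if "x \<in> T" "y \<in> T" for x y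
  proof -
    have "(c - x) \<bullet> (c - x) = (c - y) \<bullet> (c - y)" "(d - x) \<bullet> (d - x) = (d - y) \<bullet> (d - y)"
      using assms(2,3)[OF that] by (simp_all add: dist_norm norm_eq)
    then have "(x - y) \<bullet> w = 0"
      by (simp add: w_def inner_complex_def algebra_simps)
    then have "Re (x - y) * Re w = - (Im (x - y) * Im w)"
      by (simp add: inner_complex_def)
    moreover have "w \<bullet> w = Re w * Re w + Im w * Im w"
      by (simp add: inner_complex_def)
    ultimately have "x - y = (((x - y) \<bullet> (\<i> * w)) / (w \<bullet> w)) *\<^sub>R (\<i> * w)"
      using w by (simp add: complex_eq_iff inner_complex_def field_simps) algebra
    then show ?thesis ..
  qed
  then have "collinear T" unfolding collinear_def by blast
  with assms(1) show False by simp
qed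

text \<open>The positions for x that spoil genericity form a null set, while every ball has positive
  measure.\<close>

lemma generic_extend:
  assumes "generic V F" "finite F" "finite V" "V \<subseteq> F" "e > 0"
  obtains x where "x \<in> ball p e" "x \<notin> F" "generic V (insert x F)"
proof -
  define circ where "circ T = {x. \<exists>c. (\<forall>y\<in>T. dist c x = dist c y)}" for T :: "complex set"
  \<comment> \<open>Avoiding the four parts in turn prevents x from repeating an old point, lying on
    a line through two, being concyclic with three, and being as far from a vertex as an old
    point.\<close>
  define Bad where "Bad = F \<union> (\<Union>(a, b)\<in>F \<times> F. affine hull {a, b})
    \<union> (\<Union>T\<in>{T \<in> Pow F. \<not> collinear T}. circ T)
    \<union> (\<Union>(v, y)\<in>V \<times> F. sphere v (dist v y))"
  have "negligible (affine hull {a, b})" for a b :: complex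
    by (intro negligible_convex_interior[THEN iffD2] empty_interior_affine_hull affine_imp_convex)
       (auto simp: card_insert_if)
  moreover have "negligible (circ T)" if T: "\<not> collinear T" for T
  proof (cases "circ T = {}")
    case False
    then obtain x c where c: "\<And>y. y \<in> T \<Longrightarrow> dist c x = dist c y"
      by (auto simp: circ_def)
    have "T \<noteq> {}" using T by auto
    then obtain a where "a \<in> T" by auto
    \<comment> \<open>All circles through T have the same centre, so a nonempty
      \<open>circ T\<close> lies in one circle.\<close>
    have "circ T \<subseteq> sphere c (dist c a)"
    proof
      fix y assume "y \<in> circ T"
      then obtain d where d: "\<And>t. t \<in> T \<Longrightarrow> dist d y = dist d t"
        by (auto simp: circ_def)
      have "c = d"
        using T c d by (intro circumcentre_unique[of T]) (metis, metis+)
      then show "y \<in> sphere c (dist c a)" using d \<open>a \<in> T\<close> by simp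
    qed
    then show ?thesis using negligible_sphere negligible_subset by blast
  qed simp
  ultimately have "negligible Bad"
    unfolding Bad_def using assms(2,3)
    by (intro negligible_Un negligible_Union) (auto simp: negligible_sphere negligible_finite)
  moreover have "\<not> negligible (ball p e)"
    using \<open>e > 0\<close> by (intro open_not_negligible) auto
  ultimately obtain x where x: "x \<in> ball p e" "x \<notin> Bad"
    using negligible_subset by blast
  have line: "\<not> collinear {a, b, x}" if "a \<in> F" "b \<in> F" "a \<noteq> b" for a b
    using x that collinear_3_affine_hull[of a b x] by (auto simp: Bad_def)
  have old: "\<not> collinear {a, b, d}" if "a \<in> F" "b \<in> F" "d \<in> F" "a \<noteq> b" "b \<noteq> d" "a \<noteq> d" for a b d
    using that assms(1) by (auto simp: generic_def)
  have "generic V (insert x F)"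
    unfolding generic_def
  proof (intro conjI ballI allI impI)
    fix a b d
    assume *: "a \<in> insert x F" "b \<in> insert x F" "d \<in> insert x F" "a \<noteq> b \<and> b \<noteq> d \<and> a \<noteq> d"
    then show "\<not> collinear {a, b, d}"
      using line[of a b] line[of b d] line[of a d] old[of a b d]
      by (auto simp: insert_commute)
  next
    fix c Q
    assume Q: "Q \<subseteq> insert x F \<and> card Q = 4"
    show "\<not> (\<exists>r. \<forall>q\<in>Q. dist c q = r)"
    proof (cases "x \<in> Q")
      case False
      then show ?thesis using Q assms(1) unfolding generic_def by (meson subset_insert)
    next
      case True
      have T: "card (Q - {x}) = 3" using Q True by simp
      then obtain a b d where abd: "Q - {x} = {a, b, d}" "a \<noteq> b" "b \<noteq> d" "a \<noteq> d"
        by (auto simp: card_3_iff)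
      have "Q - {x} \<subseteq> F" using Q by auto
      moreover have "\<not> collinear (Q - {x})"
        using old[of a b d] abd \<open>Q - {x} \<subseteq> F\<close> by auto
      ultimately have "x \<notin> circ (Q - {x})" using x by (auto simp: Bad_def)
      then obtain y where "y \<in> Q" "dist c x \<noteq> dist c y" by (auto simp: circ_def)
      then show ?thesis using True by metis
    qed
  next
    fix v a b
    assume "v \<in> V" "a \<in> insert x F - V" "b \<in> insert x F - V" "a \<noteq> b"
    moreover have "dist v x \<noteq> dist v y" if "y \<in> F" for y
      using x that \<open>v \<in> V\<close> by (auto simp: Bad_def)
    ultimately show "dist v a \<noteq> dist v b"
      using assms(1) unfolding generic_def by (metis Diff_iff insertE)
  qed
  with x show thesis by (intro that) (auto simp: Bad_def)
qed

text \<open>Points are added one at a time. The targets \<open>p i\<close> may coincide; the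
  \<open>q i\<close> are still distinct, each being chosen off the earlier ones.\<close>

lemma generic_approximation:
  assumes "finite I" "finite V" "generic V V" "e > 0"
  shows "\<exists>q. inj_on q I \<and> q ` I \<inter> V = {} \<and> generic V (q ` I \<union> V) \<and> (\<forall>i\<in>I. dist (q i) (p i) < e)"
  using assms(1)
proof (induction I rule: finite_induct)
  case empty
  then show ?case using assms by simp
next
  case (insert i I)
  then obtain q where q: "inj_on q I" "q ` I \<inter> V = {}" "generic V (q ` I \<union> V)"
      "\<forall>j\<in>I. dist (q j) (p j) < e"
    by auto
  obtain x where x: "x \<in> ball (p i) e" "x \<notin> q ` I \<union> V" "generic V (insert x (q ` I \<union> V))"
    using generic_extend[OF q(3), of e "p i"] assms insert.hyps by auto
  let ?q = "q(i := x)"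
  have im: "?q ` I = q ` I" using insert.hyps by auto
  have "inj_on ?q (insert i I)"
    using q(1) x(2) insert.hyps im by (auto simp: inj_on_def)
  moreover have "?q ` insert i I \<inter> V = {}" "generic V (?q ` insert i I \<union> V)"
    using q(2) x(2,3) im insert.hyps by (auto simp del: fun_upd_apply simp: fun_upd_same)
  moreover have "\<forall>j\<in>insert i I. dist (?q j) (p j) < e"
    using q(4) x(1) by (auto simp: dist_commute)
  ultimately show ?case by blast
qed

text \<open>Geodesic distances are Euclidean here, and P has no reflex vertex because its
  intersection with any ball is convex.\<close>

lemma general_position_convex:
  assumes "convex P" "set vs \<subseteq> P" "S \<subseteq> P" "S \<inter> set vs = {}" "generic (set vs) (S \<union> set vs)"
  shows "general_position P vs S"
  unfolding general_position_def
proof (intro conjI ballI allI impI notI)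
  fix x y z
  assume *: "x \<in> S" "y \<in> S" "z \<in> S" "x \<noteq> y \<and> y \<noteq> z \<and> x \<noteq> z" "y \<in> gpath P x z"
  then have "y \<in> closed_segment x z"
    using gpath_convex_subset[OF assms(1)] assms(3) by blast
  then have "collinear {x, y, z}"
    using between_imp_collinear[of x z y] by (auto simp: between_mem_segment insert_commute)
  with * show False using assms(5) by (auto simp: generic_def)
next
  assume "\<exists>c\<in>P. \<exists>r Q. Q \<subseteq> S \<union> set vs \<and> card Q = 4 \<and> (\<forall>q\<in>Q. gdist P c q = r)"
  then obtain c r Q where Q: "c \<in> P" "Q \<subseteq> S \<union> set vs" "card Q = 4" "\<forall>q\<in>Q. gdist P c q = r"
    by blast
  then have "\<forall>q\<in>Q. dist c q = r"
    using gdist_convex[OF assms(1)] assms(2,3) by (metis Un_least subsetD)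
  with Q(2,3) show False using assms(5) unfolding generic_def by blast
next
  fix x y :: complex and p
  assume "x \<noteq> y \<and> reflex_vertex P vs p"
  then have "\<not> convex (P \<inter> ball p 1)" by (auto simp: reflex_vertex_def)
  then show False using assms(1) by (simp add: convex_Int)
next
  fix x y v
  assume *: "x \<in> S" "y \<in> S" "v \<in> set vs" "x \<noteq> y" "gdist P x v = gdist P y v"
  then have "dist v x = dist v y"
    using gdist_convex[OF assms(1)] assms(2,3) by (metis dist_commute subsetD)
  moreover have "x \<in> S \<union> set vs - set vs" "y \<in> S \<union> set vs - set vs"
    using * assms(4) by auto
  ultimately show False using * assms(5) unfolding generic_def by blast
qed

section \<open>Stability of disks under perturbation\<close>

text \<open>Parametrises the perpendicular bisector of a and b by t. For fixed t it is continuous in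
  a and b, so a centre can follow its two boundary points as they move.\<close>

definition bisector_point :: "real \<Rightarrow> complex \<Rightarrow> complex \<Rightarrow> complex" where
  "bisector_point t a b = (a + b) / 2 + of_real t * \<i> * (b - a)"

lemma dist_bisector_point: "dist (bisector_point t a b) a = dist (bisector_point t a b) b"
  unfolding dist_norm norm_eq_sqrt_inner
  by (rule arg_cong[where f = sqrt])
     (simp add: bisector_point_def inner_complex_def field_simps)

text \<open>The vector from the midpoint to c is orthogonal to b - a, hence a real multiple of its
  quarter turn.\<close>

lemma equidistant_imp_bisector_point:
  assumes "a \<noteq> b" "dist c a = dist c b"
  obtains t where "c = bisector_point t a b"
proof -
  define w d where "w = b - a" and "d = c - (a + b) / 2"
  have "(c - a) \<bullet> (c - a) = (c - b) \<bullet> (c - b)"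
    using assms(2) by (simp add: dist_norm norm_eq)
  then have "d \<bullet> w = 0"
    by (simp add: d_def w_def inner_complex_def field_simps)
  then have eq: "Re d * Re w = - (Im d * Im w)"
    by (simp add: inner_complex_def)
  have "w \<bullet> w \<noteq> 0" using assms(1) by (simp add: w_def)
  moreover have "w \<bullet> w = Re w * Re w + Im w * Im w"
    by (simp add: inner_complex_def)
  ultimately have "d = of_real ((d \<bullet> (\<i> * w)) / (w \<bullet> w)) * \<i> * w"
    using eq by (simp add: complex_eq_iff inner_complex_def field_simps) algebra
  then have "c = bisector_point ((d \<bullet> (\<i> * w)) / (w \<bullet> w)) a b"
    by (simp add: bisector_point_def d_def w_def algebra_simps)
  then show thesis by (rule that)
qed

text \<open>With t fixed, the moved centres converge to c. Each of the finitely many points strictly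
  outside the disk eventually stays strictly outside, so the count cannot grow. Counting indices
  keeps the multiplicity of coinciding limit points.\<close>

lemma few_in_disk_stable:
  fixes p :: "'i \<Rightarrow> complex"
  assumes I: "finite I" and lim: "\<And>k. k \<in> I \<Longrightarrow> (\<lambda>m. q m k) \<longlonglongrightarrow> p k"
    and ij: "i \<in> I" "j \<in> I" "p i \<noteq> p j"
    and c: "norm c < \<rho>" "dist c (p i) = dist c (p j)"
    and few: "card {k \<in> I. dist c (p k) \<le> dist c (p i)} \<le> K"
  shows "\<forall>\<^sub>F m in sequentially. \<exists>d. norm d < \<rho> \<and> dist d (q m i) = dist d (q m j) \<and>
           card {k \<in> I. dist d (q m k) \<le> dist d (q m i)} \<le> K"
proof -
  obtain t where t: "c = bisector_point t (p i) (p j)"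
    using equidistant_imp_bisector_point[OF ij(3) c(2)] .
  define d where "d m = bisector_point t (q m i) (q m j)" for m
  have d: "d \<longlonglongrightarrow> c"
    unfolding d_def t bisector_point_def by (intro tendsto_intros lim ij) simp
  have "\<forall>\<^sub>F m in sequentially. dist c (p k) > dist c (p i) \<longrightarrow> dist (d m) (q m k) > dist (d m) (q m i)"
    if "k \<in> I" for k
  proof (cases "dist c (p k) > dist c (p i)")
    case True
    have "(\<lambda>m. dist (d m) (q m k) - dist (d m) (q m i)) \<longlonglongrightarrow> dist c (p k) - dist c (p i)"
      by (intro tendsto_intros d lim ij that)
    then have "\<forall>\<^sub>F m in sequentially. 0 < dist (d m) (q m k) - dist (d m) (q m i)"
      using True by (intro order_tendstoD) auto
    then show ?thesis by (rule eventually_mono) simp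
  qed simp
  then have "\<forall>\<^sub>F m in sequentially. \<forall>k\<in>I. dist c (p k) > dist c (p i) \<longrightarrow>
      dist (d m) (q m k) > dist (d m) (q m i)"
    using I by (simp add: eventually_ball_finite)
  moreover have "\<forall>\<^sub>F m in sequentially. norm (d m) < \<rho>"
    using tendsto_norm[OF d] c(1) by (rule order_tendstoD)
  ultimately show ?thesis
  proof eventually_elim
    case (elim m)
    have "card {k \<in> I. dist (d m) (q m k) \<le> dist (d m) (q m i)}
        \<le> card {k \<in> I. dist c (p k) \<le> dist c (p i)}"
      using elim(1) I by (intro card_mono) (auto simp: not_less[symmetric])
    then show ?case
      using elim(2) few dist_bisector_point[of t "q m i" "q m j"] unfolding d_def[symmetric]
      by (intro exI[of _ "d m"]) auto
  qed
qed

text \<open>Generic approximations with error below 1/(m+1) converge to p, and since there are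
  finitely many pairs and points, one m serves all. The norm bounds are strict, hence open, and so
  survive; they will keep points and centres inside the polygon.\<close>

lemma generic_configuration:
  fixes p :: "'i \<Rightarrow> complex"
  assumes V: "finite V" "generic V V" and I: "finite I" and sub: "RI \<subseteq> I" "BI \<subseteq> I"
    and small: "\<And>k. k \<in> I \<Longrightarrow> norm (p k) < \<rho>"
    and disk: "\<And>i j. i \<in> RI \<Longrightarrow> j \<in> BI \<Longrightarrow> p i \<noteq> p j \<and> (\<exists>c. norm c < \<rho> \<and>
           dist c (p i) = dist c (p j) \<and> card {k \<in> I. dist c (p k) \<le> dist c (p i)} \<le> K)"
  obtains q where "inj_on q I" "q ` I \<inter> V = {}" "generic V (q ` I \<union> V)"
    "\<forall>k\<in>I. norm (q k) < \<rho>"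
    "\<forall>i\<in>RI. \<forall>j\<in>BI. \<exists>c. norm c < \<rho> \<and>
       dist c (q i) = dist c (q j) \<and> card {k \<in> I. dist c (q k) \<le> dist c (q i)} \<le> K"
proof -
  have "\<forall>m. \<exists>q. inj_on q I \<and> q ` I \<inter> V = {} \<and> generic V (q ` I \<union> V) \<and>
      (\<forall>i\<in>I. dist (q i) (p i) < inverse (real (Suc m)))"
    using generic_approximation[OF I V] by simp
  from choice[OF this] obtain q where q: "\<And>m. inj_on (q m) I" "\<And>m. q m ` I \<inter> V = {}"
      "\<And>m. generic V (q m ` I \<union> V)" "\<And>m i. i \<in> I \<Longrightarrow> dist (q m i) (p i) < inverse (real (Suc m))"
    by blast
  have lim: "(\<lambda>m. q m k) \<longlonglongrightarrow> p k" if "k \<in> I" for k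
  proof -
    have "(\<lambda>m. dist (q m k) (p k)) \<longlonglongrightarrow> 0"
      using q(4)[OF that]
      by (intro tendsto_sandwich[OF _ _ tendsto_const LIMSEQ_inverse_real_of_nat])
         (auto intro!: always_eventually less_imp_le)
    then show ?thesis by (rule tendsto_dist_iff[THEN iffD2])
  qed
  have fin: "finite RI" "finite BI" using I sub finite_subset by blast+
  have "\<forall>\<^sub>F m in sequentially. \<forall>i\<in>RI. \<forall>j\<in>BI. \<exists>c. norm c < \<rho> \<and>
       dist c (q m i) = dist c (q m j) \<and> card {k \<in> I. dist c (q m k) \<le> dist c (q m i)} \<le> K"
    using fin
  proof (intro eventually_ball_finite ballI)
    fix i j assume ij: "i \<in> RI" "j \<in> BI"
    then obtain c where "norm c < \<rho>" "dist c (p i) = dist c (p j)"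
        "card {k \<in> I. dist c (p k) \<le> dist c (p i)} \<le> K"
      using disk by blast
    then show "\<forall>\<^sub>F m in sequentially. \<exists>c. norm c < \<rho> \<and>
       dist c (q m i) = dist c (q m j) \<and> card {k \<in> I. dist c (q m k) \<le> dist c (q m i)} \<le> K"
      using ij sub disk by (intro few_in_disk_stable[OF I lim]) auto
  qed
  moreover have "\<forall>\<^sub>F m in sequentially. \<forall>k\<in>I. norm (q m k) < \<rho>"
    using I
  proof (intro eventually_ball_finite ballI)
    fix k assume "k \<in> I"
    then show "\<forall>\<^sub>F m in sequentially. norm (q m k) < \<rho>"
      using tendsto_norm[OF lim] small by (intro order_tendstoD) auto
  qed
  ultimately have "\<forall>\<^sub>F m in sequentially. (\<forall>i\<in>RI. \<forall>j\<in>BI. \<exists>c. norm c < \<rho> \<and>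
       dist c (q m i) = dist c (q m j) \<and> card {k \<in> I. dist c (q m k) \<le> dist c (q m i)} \<le> K) \<and>
       (\<forall>k\<in>I. norm (q m k) < \<rho>)"
    by (rule eventually_conj)
  from eventually_happens'[OF sequentially_bot this] obtain m where "\<forall>i\<in>RI. \<forall>j\<in>BI. \<exists>c. norm c < \<rho> \<and>
       dist c (q m i) = dist c (q m j) \<and> card {k \<in> I. dist c (q m k) \<le> dist c (q m i)} \<le> K"
      "\<forall>k\<in>I. norm (q m k) < \<rho>"
    by blast
  then show thesis
    using q(1-3)[of m] by (intro that[of "q m"]) auto
qed

section \<open>The configuration\<close>

lemma dist_Complex_le_iff:
  "dist (Complex a b) (Complex x y) \<le> dist (Complex a b) (Complex u v) \<longleftrightarrow>
     (x - a)\<^sup>2 + (y - b)\<^sup>2 \<le> (u - a)\<^sup>2 + (v - b)\<^sup>2"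
  by (simp add: dist_norm cmod_def power2_commute)

lemma dist_Complex_eq_iff:
  "dist (Complex a b) (Complex x y) = dist (Complex a b) (Complex u v) \<longleftrightarrow>
     (x - a)\<^sup>2 + (y - b)\<^sup>2 = (u - a)\<^sup>2 + (v - b)\<^sup>2"
  by (simp add: dist_norm cmod_def power2_commute)

text \<open>The centre is (r, h) and the radius |r|, with tangency at (0, h). Passing through (x, y)
  means 2rx = 1 + h^2 - 2hy, which is positive, so r has the sign of x and the disk lies on that
  side of the axis.\<close>

lemma disk_tangent_vertical:
  fixes h x y :: real
  assumes h: "1 \<le> \<bar>h\<bar>" "\<bar>h\<bar> \<le> 2" and xy: "x\<^sup>2 + y\<^sup>2 = 1" "\<bar>y\<bar> \<le> 1/5"
  obtains c where "norm c < 10" "dist c (Complex 0 h) = dist c (Complex x y)"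
    "\<And>u v. dist c (Complex u v) \<le> dist c (Complex 0 h) \<Longrightarrow> u * x > 0 \<or> u = 0 \<and> v = h"
    "\<And>t. 0 < t \<Longrightarrow> t \<le> 1/4 \<Longrightarrow> \<not> dist c (Complex t 0) \<le> dist c (Complex 0 h)"
proof -
  have y2: "y\<^sup>2 \<le> (1/5)\<^sup>2" using xy(2) by (metis abs_ge_zero power2_abs power_mono)
  \<comment> \<open>Indeed x^2 is at least 24/25, which exceeds 81/100.\<close>
  have x9: "9/10 \<le> \<bar>x\<bar>"
  proof (rule ccontr)
    assume "\<not> 9/10 \<le> \<bar>x\<bar>"
    then have "\<bar>x\<bar>\<^sup>2 \<le> (9/10)\<^sup>2" by (intro power_mono) auto
    then show False using xy y2 by (simp add: power2_eq_square)
  qed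
  then have x0: "x \<noteq> 0" by auto
  define s where "s = 1 + h\<^sup>2 - 2 * h * y"
  define r where "r = s / (2 * x)"
  have h2: "1 \<le> h\<^sup>2" "h\<^sup>2 \<le> 4"
    using h power_mono[of 1 "\<bar>h\<bar>" 2] power_mono[of "\<bar>h\<bar>" 2 2] by auto
  have "\<bar>h * y\<bar> \<le> \<bar>h\<bar> * (1/5)"
    unfolding abs_mult using xy(2) by (intro mult_left_mono) auto
  then have hy: "\<bar>h * y\<bar> \<le> \<bar>h\<bar> / 5" by simp
  have s: "s > 0" "s \<le> 1 + h\<^sup>2 + 2 * \<bar>h\<bar> / 5"
    using hy h h2 by (auto simp: s_def abs_le_iff)
  have rx: "2 * r * x = s" using x0 by (simp add: r_def)
  have r_abs: "\<bar>r\<bar> = s / (2 * \<bar>x\<bar>)" using s(1) by (simp add: r_def abs_divide abs_mult)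
  also have "\<dots> \<le> s / (2 * (9/10))"
    using s(1) x9 by (intro divide_left_mono) auto
  finally have rs: "\<bar>r\<bar> \<le> s * 5 / 9" by simp
  show thesis
  proof (rule that[of "Complex r h"])
    have "norm (Complex r h) \<le> \<bar>r\<bar> + \<bar>h\<bar>" using cmod_le[of "Complex r h"] by simp
    then show "norm (Complex r h) < 10" using rs s(2) h h2 by linarith
  next
    have "(0 - r)\<^sup>2 + (h - h)\<^sup>2 = (x - r)\<^sup>2 + (y - h)\<^sup>2"
      using rx xy(1) unfolding s_def by (simp add: power2_eq_square algebra_simps)
    then show "dist (Complex r h) (Complex 0 h) = dist (Complex r h) (Complex x y)"
      unfolding dist_Complex_eq_iff .
  next
    fix u v
    assume "dist (Complex r h) (Complex u v) \<le> dist (Complex r h) (Complex 0 h)"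
    then have *: "u\<^sup>2 + (v - h)\<^sup>2 \<le> 2 * r * u"
      unfolding dist_Complex_le_iff by (simp add: power2_eq_square algebra_simps)
    have "u * x > 0" if "u \<noteq> 0"
    proof -
      have "0 < u\<^sup>2" using that by simp
      then have "0 < 2 * r * u" using * zero_le_power2[of "v - h"] by linarith
      moreover have "2 * r * u * x\<^sup>2 = s * (u * x)" using rx by (simp add: power2_eq_square algebra_simps)
      ultimately have "0 < s * (u * x)" using x0 by (metis mult_pos_pos zero_less_power2)
      then show ?thesis using s(1) zero_less_mult_pos by blast
    qed
    then show "u * x > 0 \<or> u = 0 \<and> v = h" using * by (cases "u = 0") auto
  next
    fix t :: real assume t: "0 < t" "t \<le> 1/4"
    \<comment> \<open>The point (t, 0) is outside iff 2rt < t^2 + h^2. Here 2rt is at most 5s/18,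
      and s is at most 12/5 times h^2.\<close>
    have "2 * r * t < h\<^sup>2"
    proof -
      have "r * t \<le> \<bar>r\<bar> * t" using t by (intro mult_right_mono) auto
      moreover have "\<bar>r\<bar> * t \<le> \<bar>r\<bar> * (1/4)" using t by (intro mult_left_mono) auto
      ultimately have "2 * r * t \<le> 2 * \<bar>r\<bar> * (1/4)" by linarith
      also have "\<dots> \<le> s * 5 / 18" using rs by simp
      also have "\<dots> < h\<^sup>2"
      proof -
        have "\<bar>h\<bar> \<le> h\<^sup>2" using h mult_mono[of 1 "\<bar>h\<bar>" "\<bar>h\<bar>" "\<bar>h\<bar>"]
          by (simp add: power2_eq_square abs_mult_self_eq flip: abs_mult)
        then show ?thesis using s(2) h2 by linarith
      qed
      finally show ?thesis .
    qed
    then show "\<not> dist (Complex r h) (Complex t 0) \<le> dist (Complex r h) (Complex 0 h)"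
      using t unfolding dist_Complex_le_iff by (simp add: power2_eq_square algebra_simps)
        (smt (verit, ccfv_SIG) mult_pos_pos)
  qed
qed

text \<open>The centre is (t, r) and the radius |r|, with tangency at (t, 0); passing through (0, h)
  means 2rh = t^2 + h^2, so r has the sign of h. A point (u, v) in the disk satisfies (u - t)^2 +
  v^2 \<le> 2rv, but on the given part of the unit circle the left side is at least 1/2 and the
  right side at most 33/80.\<close>

lemma disk_tangent_horizontal:
  fixes h t :: real
  assumes h: "1 \<le> \<bar>h\<bar>" "\<bar>h\<bar> \<le> 2" and t: "0 < t" "t \<le> 1/4"
  obtains c where "norm c < 10" "dist c (Complex 0 h) = dist c (Complex t 0)"
    "\<And>u v. dist c (Complex u v) \<le> dist c (Complex 0 h) \<Longrightarrow> v * h > 0 \<or> u = t \<and> v = 0"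
    "\<And>u v. u\<^sup>2 + v\<^sup>2 = 1 \<Longrightarrow> \<bar>v\<bar> \<le> 1/5 \<Longrightarrow> \<not> dist c (Complex u v) \<le> dist c (Complex 0 h)"
proof -
  have h0: "h \<noteq> 0" using h by auto
  define s where "s = t\<^sup>2 + h\<^sup>2"
  define r where "r = s / (2 * h)"
  have t2: "t\<^sup>2 \<le> 1/16" using t power_mono[of t "1/4" 2] by (simp add: power_divide)
  have h2: "1 \<le> h\<^sup>2" "h\<^sup>2 \<le> 4"
    using h power_mono[of 1 "\<bar>h\<bar>" 2] power_mono[of "\<bar>h\<bar>" 2 2] by auto
  have s: "s > 0" using h0 by (auto simp: s_def intro: add_nonneg_pos)
  have rh: "2 * r * h = s" using h0 by (simp add: r_def)
  have "\<bar>r\<bar> = t\<^sup>2 / (2 * \<bar>h\<bar>) + \<bar>h\<bar> / 2"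
    using h0 s by (simp add: r_def s_def abs_divide abs_mult field_simps power2_eq_square)
  moreover have "t\<^sup>2 / (2 * \<bar>h\<bar>) \<le> t\<^sup>2 / 2" using h by (intro divide_left_mono) auto
  ultimately have r: "\<bar>r\<bar> \<le> 33/32" using t2 h by linarith
  show thesis
  proof (rule that[of "Complex t r"])
    have "norm (Complex t r) \<le> \<bar>t\<bar> + \<bar>r\<bar>" using cmod_le[of "Complex t r"] by simp
    then show "norm (Complex t r) < 10" using r t by linarith
  next
    have "(0 - t)\<^sup>2 + (h - r)\<^sup>2 = (t - t)\<^sup>2 + (0 - r)\<^sup>2"
      using rh unfolding s_def by (simp add: power2_eq_square algebra_simps)
    then show eq: "dist (Complex t r) (Complex 0 h) = dist (Complex t r) (Complex t 0)"
      unfolding dist_Complex_eq_iff .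
    have *: "(u - t)\<^sup>2 + v\<^sup>2 \<le> 2 * r * v"
      if "dist (Complex t r) (Complex u v) \<le> dist (Complex t r) (Complex 0 h)" for u v
      using that unfolding eq dist_Complex_le_iff by (simp add: power2_eq_square algebra_simps)
    {
      fix u v
      assume "dist (Complex t r) (Complex u v) \<le> dist (Complex t r) (Complex 0 h)"
      note in_disk = *[OF this]
      have "v * h > 0" if "v \<noteq> 0"
      proof -
        have "0 < v\<^sup>2" using that by simp
        then have "0 < 2 * r * v" using in_disk zero_le_power2[of "u - t"] by linarith
        moreover have "2 * r * v * h\<^sup>2 = s * (v * h)" using rh by (simp add: power2_eq_square algebra_simps)
        ultimately have "0 < s * (v * h)" using h0 by (metis mult_pos_pos zero_less_power2)
        then show ?thesis using s zero_less_mult_pos by blast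
      qed
      then show "v * h > 0 \<or> u = t \<and> v = 0" using in_disk by (cases "v = 0") auto
    next
      fix u v :: real
      assume uv: "u\<^sup>2 + v\<^sup>2 = 1" "\<bar>v\<bar> \<le> 1/5"
      have "u\<^sup>2 \<le> 1" using uv(1) zero_le_power2[of v] by linarith
      then have u: "u \<le> 1" by (metis abs_le_D1 abs_square_le_1)
      have "u * t \<le> 1 * (1/4)"
        using t u by (smt (verit) mult_left_le_one_le mult_nonneg_nonneg mult_less_0_iff mult.commute)
      moreover have "(u - t)\<^sup>2 + v\<^sup>2 = 1 - 2 * (u * t) + t\<^sup>2"
        using uv(1) by (simp add: power2_eq_square algebra_simps)
      ultimately have "(u - t)\<^sup>2 + v\<^sup>2 \<ge> 1/2" using zero_le_power2[of t] by linarith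
      moreover have "2 * r * v \<le> 2 * (\<bar>r\<bar> * \<bar>v\<bar>)"
        using abs_ge_self[of "r * v"] by (simp add: abs_mult)
      moreover have "\<bar>r\<bar> * \<bar>v\<bar> \<le> 33/32 * (1/5)" using r uv(2) by (intro mult_mono) auto
      ultimately show "\<not> dist (Complex t r) (Complex u v) \<le> dist (Complex t r) (Complex 0 h)"
        using *[of u v] by linarith
    }
  qed
qed

text \<open>Thales: the disk with diameter from 0 to (x, y) consists of the points seeing that
  diameter under an angle of at least 90 degrees, up to its endpoints.\<close>

lemma in_disk_half_iff:
  "dist (Complex (x/2) (y/2)) (Complex u v) \<le> dist (Complex (x/2) (y/2)) 0 \<longleftrightarrow>
     u\<^sup>2 + v\<^sup>2 \<le> u * x + v * y"
proof -
  have "(u - x/2)\<^sup>2 + (v - y/2)\<^sup>2 = (0 - x/2)\<^sup>2 + (0 - y/2)\<^sup>2 + (u\<^sup>2 + v\<^sup>2 - (u * x + v * y))"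
    by (simp add: power2_eq_square algebra_simps)
  then show ?thesis
    using dist_Complex_le_iff[of "x/2" "y/2" u v 0 0] by (simp only: zero_complex.code) simp
qed

text \<open>
  The points are indexed by sites rather than identified with their places, because all
  \<open>Centre\<close> sites share the place \<open>0\<close> until the configuration is perturbed.
\<close>
datatype site = Top nat | Bottom nat | Centre nat | East nat | West nat | Inner nat

text \<open>All four sequences are injective, with bounds uniform in j, so a cluster can hold any
  number of sites. The bounds 2, 1/5 and 1/4 on height, lift and offset are those of the tangent
  disk estimates; width puts the rim sites on the unit circle.\<close>

definition height :: "nat \<Rightarrow> real" where "height j = 1 + 1 / real (Suc j)"
definition lift :: "nat \<Rightarrow> real" where "lift j = 1 / (5 * real (Suc j))"
definition width :: "nat \<Rightarrow> real" where "width j = sqrt (1 - (lift j)\<^sup>2)"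
definition offset :: "nat \<Rightarrow> real" where "offset j = 1 / (4 * real (Suc j))"

fun place :: "site \<Rightarrow> complex" where
  "place (Top j) = Complex 0 (height j)"
| "place (Bottom j) = Complex 0 (- height j)"
| "place (Centre j) = 0"
| "place (East j) = Complex (width j) (lift j)"
| "place (West j) = Complex (- width j) (lift j)"
| "place (Inner j) = Complex (offset j) 0"

lemma height_bounds: "1 < height j" "height j \<le> 2"
  by (auto simp: height_def field_simps)

lemma lift_bounds: "0 < lift j" "lift j \<le> 1/5"
  by (auto simp: lift_def field_simps)

lemma offset_bounds: "0 < offset j" "offset j \<le> 1/4"
  by (auto simp: offset_def field_simps)

lemma width_bounds: "0 < width j" "(width j)\<^sup>2 + (lift j)\<^sup>2 = 1"
proof -
  have "(lift j)\<^sup>2 \<le> (1/5)\<^sup>2" using lift_bounds[of j] by (intro power_mono) auto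
  then have "(lift j)\<^sup>2 < 1" by (simp add: power_divide)
  then show "0 < width j" "(width j)\<^sup>2 + (lift j)\<^sup>2 = 1" by (auto simp: width_def)
qed

lemma param_inj [simp]:
  "height i = height j \<longleftrightarrow> i = j" "lift i = lift j \<longleftrightarrow> i = j" "offset i = offset j \<longleftrightarrow> i = j"
  by (auto simp: height_def lift_def offset_def)

section \<open>Which sites each disk can contain\<close>

text \<open>Tangency to the y-axis at r leaves only r on that axis and removes the opposite rim
  cluster. The \<open>Inner\<close> sites may lie on the same side as b and are removed by the
  separate estimate.\<close>

lemma disk_spoke_rim:
  assumes "r = Top i \<or> r = Bottom i"
    and "b = East j \<and> side = range East \<or> b = West j \<and> side = range West"
  obtains c where "norm c < 10" "dist c (place r) = dist c (place b)"
    "{k. dist c (place k) \<le> dist c (place r)} \<subseteq> insert r side"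
proof -
  define h x where "h = Im (place r)" and "x = Re (place b)"
  have r: "place r = Complex 0 h" using assms(1) by (auto simp: h_def)
  have b: "place b = Complex x (lift j)" using assms(2) by (auto simp: x_def)
  have "1 \<le> \<bar>h\<bar>" "\<bar>h\<bar> \<le> 2" "x\<^sup>2 + (lift j)\<^sup>2 = 1" "\<bar>lift j\<bar> \<le> 1/5"
    using assms height_bounds[of i] width_bounds[of j] lift_bounds[of j] by (auto simp: h_def x_def)
  from disk_tangent_vertical[OF this] obtain c where c: "norm c < 10"
      "dist c (Complex 0 h) = dist c (Complex x (lift j))"
      "\<And>u v. dist c (Complex u v) \<le> dist c (Complex 0 h) \<Longrightarrow> u * x > 0 \<or> u = 0 \<and> v = h"
      "\<And>t. 0 < t \<Longrightarrow> t \<le> 1/4 \<Longrightarrow> \<not> dist c (Complex t 0) \<le> dist c (Complex 0 h)"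
    by blast
  have "k \<in> insert r side" if k: "dist c (place k) \<le> dist c (place r)" for k
  proof -
    have *: "Re (place k) * x > 0 \<or> Re (place k) = 0 \<and> Im (place k) = h"
      using c(3)[of "Re (place k)" "Im (place k)"] k r by simp
    show ?thesis
    proof (cases k)
      case (Inner l)
      then show ?thesis using c(4)[OF offset_bounds] k r by simp
    next
      case (Centre l)
      then show ?thesis using * \<open>1 \<le> \<bar>h\<bar>\<close> by simp
    next
      case (Top l)
      then show ?thesis using * assms(1) height_bounds[of i] height_bounds[of l] by (auto simp: h_def)
    next
      case (Bottom l)
      then show ?thesis using * assms(1) height_bounds[of i] height_bounds[of l] by (auto simp: h_def)
    next
      case (East l)
      then show ?thesis
        using * assms(2) width_bounds(1)[of l] width_bounds(1)[of j]
        by (auto simp: x_def zero_less_mult_iff)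
    next
      case (West l)
      then show ?thesis
        using * assms(2) width_bounds(1)[of l] width_bounds(1)[of j]
        by (auto simp: x_def mult_less_0_iff zero_less_mult_iff)
    qed
  qed
  then show thesis using c(1,2) r b by (intro that[of c]) auto
qed

text \<open>The disk on the diameter from 0 to b touches the unit circle from inside at b, and meets
  the y-axis only at heights up to |y|, far below the spokes.\<close>

lemma disk_centre_rim:
  assumes "b = East j \<or> b = West j"
  obtains c where "norm c < 10" "dist c (place (Centre i)) = dist c (place b)"
    "{k. dist c (place k) \<le> dist c (place (Centre i))} \<subseteq> insert b (range Centre \<union> range Inner)"
proof -
  define x y where "x = Re (place b)" and "y = Im (place b)"
  have b: "place b = Complex x y" by (simp add: x_def y_def)
  have xy: "x\<^sup>2 + y\<^sup>2 = 1" "\<bar>y\<bar> \<le> 1/5"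
    using assms width_bounds[of j] lift_bounds[of j] by (auto simp: x_def y_def)
  define c where "c = Complex (x/2) (y/2)"
  have x: "\<bar>x\<bar> \<le> 1" using xy(1) by (metis abs_square_le_1 le_add_same_cancel1 zero_le_power2)
  have "norm c \<le> \<bar>x/2\<bar> + \<bar>y/2\<bar>" unfolding c_def using cmod_le[of "Complex (x/2) (y/2)"] by simp
  then have 1: "norm c < 10" using x xy(2) by linarith
  have 2: "dist c 0 = dist c (place b)"
    unfolding b c_def using dist_Complex_eq_iff[of "x/2" "y/2" 0 0 x y]
    by (simp add: zero_complex.code power2_eq_square field_simps)
  have "k \<in> insert b (range Centre \<union> range Inner)" if k: "dist c (place k) \<le> dist c 0" for k
  proof -
    define u v where "u = Re (place k)" and "v = Im (place k)"
    have uv: "place k = Complex u v" by (simp add: u_def v_def)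
    have *: "u\<^sup>2 + v\<^sup>2 \<le> u * x + v * y"
      using k unfolding uv c_def in_disk_half_iff .
    have rim: "u = x \<and> v = y" if "u\<^sup>2 + v\<^sup>2 = 1"
    proof -
      \<comment> \<open>For two unit vectors the left side is 2 - 2(ux + vy).\<close>
      have "(u - x)\<^sup>2 + (v - y)\<^sup>2 \<le> 0"
        using * that xy(1) by (simp add: power2_eq_square algebra_simps)
      then show ?thesis by (simp add: sum_power2_le_zero_iff)
    qed
    have spoke: False if "u = 0" "\<bar>v\<bar> > 1"
    proof -
      have "\<bar>v\<bar> * \<bar>v\<bar> \<le> \<bar>v\<bar> * \<bar>y\<bar>"
        using * that abs_ge_self[of "v * y"] by (simp add: power2_eq_square abs_mult)
      then have "\<bar>v\<bar> \<le> \<bar>y\<bar>" by (rule mult_left_le_imp_le) (use that(2) in linarith)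
      then show False using that(2) xy(2) by simp
    qed
    show ?thesis
    proof (cases k)
      case (Top l)
      then show ?thesis using spoke height_bounds[of l] by (simp add: u_def v_def)
    next
      case (Bottom l)
      then show ?thesis using spoke height_bounds[of l] by (simp add: u_def v_def)
    next
      case (East l)
      then show ?thesis
        using rim assms width_bounds[of l] width_bounds[of j] by (auto simp: u_def v_def x_def y_def)
    next
      case (West l)
      then show ?thesis
        using rim assms width_bounds[of l] width_bounds[of j] by (auto simp: u_def v_def x_def y_def)
    qed auto
  qed
  then show thesis using 1 2 by (intro that[of c]) auto
qed

lemma disk_centre_inner:
  obtains c where "norm c < 10" "dist c (place (Centre i)) = dist c (place (Inner j))"
    "{k. dist c (place k) \<le> dist c (place (Centre i))} \<subseteq> range Centre \<union> range Inner"
proof -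
  define t where "t = offset j"
  have t: "0 < t" "t \<le> 1/4" using offset_bounds by (auto simp: t_def)
  \<comment> \<open>The form \<open>0/2\<close> matches \<open>in_disk_half_iff\<close> with y =
    0.\<close>
  define c where "c = Complex (t/2) (0/2)"
  have "norm c \<le> \<bar>t/2\<bar>" unfolding c_def using cmod_le[of "Complex (t/2) (0/2)"] by simp
  then have 1: "norm c < 10" using t by linarith
  have 2: "dist c 0 = dist c (Complex t 0)"
    unfolding c_def using dist_Complex_eq_iff[of "t/2" "0/2" 0 0 t 0]
    by (simp add: zero_complex.code power2_eq_square field_simps)
  have "k \<in> range Centre \<union> range Inner" if k: "dist c (place k) \<le> dist c 0" for k
  proof -
    define u v where "u = Re (place k)" and "v = Im (place k)"
    have uv: "place k = Complex u v" by (simp add: u_def v_def)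
    have *: "u\<^sup>2 + v\<^sup>2 \<le> u * t"
      using k unfolding uv c_def in_disk_half_iff by simp
    have rim: False if "u\<^sup>2 + v\<^sup>2 = 1"
    proof -
      have "\<bar>u\<bar> \<le> 1" using that by (metis abs_square_le_1 le_add_same_cancel1 zero_le_power2)
      then have "u * t \<le> 1 * (1/4)"
        using t by (smt (verit) mult_left_le_one_le mult_nonneg_nonneg mult_less_0_iff mult.commute)
      then show False using * that by simp
    qed
    have "height l \<noteq> 0" for l using height_bounds(1)[of l] by simp
    then show ?thesis
      using * rim width_bounds by (cases k) (auto simp: u_def v_def)
  qed
  then show thesis using 1 2 by (intro that[of c]) (auto simp: t_def)
qed

text \<open>Tangency to the x-axis leaves only \<open>Inner j\<close> on that axis and removes the
  opposite spoke; rim sites may be on the same side as r and fall to the second estimate.\<close>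

lemma disk_spoke_inner:
  assumes "r = Top i \<and> spoke = range Top \<or> r = Bottom i \<and> spoke = range Bottom"
  obtains c where "norm c < 10" "dist c (place r) = dist c (place (Inner j))"
    "{k. dist c (place k) \<le> dist c (place r)} \<subseteq> insert (Inner j) spoke"
proof -
  define h where "h = Im (place r)"
  have r: "place r = Complex 0 h" using assms(1) by (auto simp: h_def)
  have "1 \<le> \<bar>h\<bar>" "\<bar>h\<bar> \<le> 2" "0 < offset j" "offset j \<le> 1/4"
    using assms height_bounds[of i] offset_bounds[of j] by (auto simp: h_def)
  from disk_tangent_horizontal[OF this] obtain c where c: "norm c < 10"
      "dist c (Complex 0 h) = dist c (Complex (offset j) 0)"
      "\<And>u v. dist c (Complex u v) \<le> dist c (Complex 0 h) \<Longrightarrow> v * h > 0 \<or> u = offset j \<and> v = 0"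
      "\<And>u v. u\<^sup>2 + v\<^sup>2 = 1 \<Longrightarrow> \<bar>v\<bar> \<le> 1/5 \<Longrightarrow> \<not> dist c (Complex u v) \<le> dist c (Complex 0 h)"
    by blast
  have "k \<in> insert (Inner j) spoke" if k: "dist c (place k) \<le> dist c (place r)" for k
  proof -
    have *: "Im (place k) * h > 0 \<or> Re (place k) = offset j \<and> Im (place k) = 0"
      using c(3)[of "Re (place k)" "Im (place k)"] k r by simp
    have rim: "\<not> ((Re (place k))\<^sup>2 + (Im (place k))\<^sup>2 = 1 \<and> \<bar>Im (place k)\<bar> \<le> 1/5)"
      using c(4)[of "Re (place k)" "Im (place k)"] k r by auto
    show ?thesis
    proof (cases k)
      case (Top l)
      then show ?thesis
        using * assms height_bounds[of i] height_bounds[of l] by (auto simp: h_def zero_less_mult_iff)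
    next
      case (Bottom l)
      then show ?thesis
        using * assms height_bounds[of i] height_bounds[of l]
        by (auto simp: h_def zero_less_mult_iff mult_less_0_iff)
    next
      case (Centre l)
      then show ?thesis using * offset_bounds[of j] by auto
    next
      case (East l)
      then show ?thesis using rim width_bounds[of l] lift_bounds[of l] by auto
    next
      case (West l)
      then show ?thesis using rim width_bounds[of l] lift_bounds[of l] by auto
    next
      case (Inner l)
      then show ?thesis using * by auto
    qed
  qed
  then show thesis using c(1,2) r by (intro that[of c]) auto
qed

lemma place_red_neq_blue:
  assumes "r \<in> range Top \<union> range Bottom \<union> range Centre" "b \<in> range East \<union> range West \<union> range Inner"
  shows "place r \<noteq> place b"
proof -
  have "Re (place r) = 0" using assms(1) by auto
  moreover have "Re (place b) \<noteq> 0"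
    using assms(2) width_bounds(1) offset_bounds(1) by (auto simp: less_imp_neq[symmetric])
  ultimately show ?thesis by auto
qed

lemma norm_place: "norm (place k) < 10"
proof (cases k)
  case (Top l)
  then show ?thesis using cmod_le[of "place k"] height_bounds[of l] by simp
next
  case (Bottom l)
  then show ?thesis using cmod_le[of "place k"] height_bounds[of l] by simp
next
  case (East l)
  then show ?thesis using width_bounds[of l] by (simp add: cmod_def)
next
  case (West l)
  then show ?thesis using width_bounds[of l] by (simp add: cmod_def)
next
  case (Inner l)
  then show ?thesis using cmod_le[of "place k"] offset_bounds[of l] by simp
qed simp

text \<open>Every disk meets a single cluster of at most k sites, plus at most one further boundary
  site. The \<open>Centre\<close> and \<open>Inner\<close> sites count as one cluster, of size
  2z.\<close>

lemma few_sites_in_disk: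
  assumes R: "RI = Top ` {..<k} \<union> Bottom ` {..<l} \<union> Centre ` {..<z}"
    and B: "BI = East ` {..<k} \<union> West ` {..<l} \<union> Inner ` {..<z}"
    and size: "l \<le> k" "2 * z \<le> k"
    and r: "r \<in> RI" and b: "b \<in> BI"
  shows "\<exists>c. norm c < 10 \<and> dist c (place r) = dist c (place b) \<and>
    card {s \<in> RI \<union> BI. dist c (place s) \<le> dist c (place r)} \<le> k + 1"
proof -
  \<comment> \<open>X is the infinite family allowed by the geometry, Y a finite set containing all
    its actual sites.\<close>
  have le: "card {s \<in> RI \<union> BI. dist c (place s) \<le> dist c (place r)} \<le> k + 1"
    if X: "{s. dist c (place s) \<le> dist c (place r)} \<subseteq> X" "(RI \<union> BI) \<inter> X \<subseteq> Y"
      "finite Y" "card Y \<le> k + 1" for c X Y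
  proof -
    have "{s \<in> RI \<union> BI. dist c (place s) \<le> dist c (place r)} \<subseteq> Y" using X(1,2) by auto
    then show ?thesis using card_mono[OF X(3)] X(4) by (meson le_trans)
  qed
  have one: "card (insert s (f ` {..<m})) \<le> k + 1" if "m \<le> k" for s :: site and f m
    using card_insert_le_m1[of "Suc k" "f ` {..<m}" s] card_image_le[of "{..<m}" f] that by simp
  have core: "card (Centre ` {..<z} \<union> Inner ` {..<z}) \<le> k"
    using card_Un_le[of "Centre ` {..<z}" "Inner ` {..<z}"] card_image_le[of "{..<z}" Centre]
      card_image_le[of "{..<z}" Inner] size by simp
  consider (spoke_rim) i j side where "r = Top i \<or> r = Bottom i"
      "b = East j \<and> side = range East \<or> b = West j \<and> side = range West"
    | (centre_rim) i j where "r = Centre i" "b = East j \<or> b = West j"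
    | (spoke_inner) i spoke j where
      "r = Top i \<and> spoke = range Top \<or> r = Bottom i \<and> spoke = range Bottom" "b = Inner j"
    | (centre_inner) i j where "r = Centre i" "b = Inner j"
    using r b unfolding R B by auto
  then show ?thesis
  proof cases
    case spoke_rim
    obtain c where c: "norm c < 10" "dist c (place r) = dist c (place b)"
        "{k. dist c (place k) \<le> dist c (place r)} \<subseteq> insert r side"
      using disk_spoke_rim[OF spoke_rim] .
    have "card {s \<in> RI \<union> BI. dist c (place s) \<le> dist c (place r)} \<le> k + 1"
      using spoke_rim(2)
    proof
      assume "b = East j \<and> side = range East"
      then show ?thesis
        using one[of k r East] by (intro le[OF c(3), of "insert r (East ` {..<k})"]) (auto simp: R B)
    next
      assume "b = West j \<and> side = range West"
      then show ?thesis
        using one[of l r West] size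
        by (intro le[OF c(3), of "insert r (West ` {..<l})"]) (auto simp: R B)
    qed
    then show ?thesis using c by blast
  next
    case centre_rim
    obtain c where c: "norm c < 10" "dist c (place r) = dist c (place b)"
        "{k. dist c (place k) \<le> dist c (place r)} \<subseteq> insert b (range Centre \<union> range Inner)"
      using disk_centre_rim[OF centre_rim(2), of i] centre_rim(1) by blast
    have "card (insert b (Centre ` {..<z} \<union> Inner ` {..<z})) \<le> k + 1"
      using core by (simp add: card_insert_if)
    then have "card {s \<in> RI \<union> BI. dist c (place s) \<le> dist c (place r)} \<le> k + 1"
      by (intro le[OF c(3), of "insert b (Centre ` {..<z} \<union> Inner ` {..<z})"]) (auto simp: R B)
    then show ?thesis using c by blast
  next
    case spoke_inner
    obtain c where c: "norm c < 10" "dist c (place r) = dist c (place b)"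
        "{k. dist c (place k) \<le> dist c (place r)} \<subseteq> insert b spoke"
      using disk_spoke_inner[OF spoke_inner(1), of j] spoke_inner(2) by blast
    have "card {s \<in> RI \<union> BI. dist c (place s) \<le> dist c (place r)} \<le> k + 1"
      using spoke_inner(1)
    proof
      assume "r = Top i \<and> spoke = range Top"
      then show ?thesis
        using one[of k b Top] by (intro le[OF c(3), of "insert b (Top ` {..<k})"]) (auto simp: R B)
    next
      assume "r = Bottom i \<and> spoke = range Bottom"
      then show ?thesis
        using one[of l b Bottom] size
        by (intro le[OF c(3), of "insert b (Bottom ` {..<l})"]) (auto simp: R B)
    qed
    then show ?thesis using c by blast
  next
    case centre_inner
    obtain c where c: "norm c < 10" "dist c (place r) = dist c (place b)"
        "{k. dist c (place k) \<le> dist c (place r)} \<subseteq> range Centre \<union> range Inner"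
      using disk_centre_inner[of i j] centre_inner by blast
    then have "card {s \<in> RI \<union> BI. dist c (place s) \<le> dist c (place r)} \<le> k + 1"
      using core by (intro le[OF c(3), of "Centre ` {..<z} \<union> Inner ` {..<z}"]) (auto simp: R B)
    then show ?thesis using c by blast
  qed
qed

section \<open>The enclosing triangle\<close>

definition tri :: "complex list" where
  "tri = [Complex (-20) (-20), Complex 60 (-20), Complex (-20) 60]"

lemma set_tri: "set tri = {Complex (-20) (-20), Complex 60 (-20), Complex (-20) 60}"
  by (simp add: tri_def)

lemma tri_not_collinear: "\<not> collinear {Complex (-20) (-20), Complex 60 (-20), Complex (-20) 60}"
proof
  assume "collinear {Complex (-20) (-20), Complex 60 (-20), Complex (-20) 60}"
  then have "Complex (-20) 60 \<in> affine hull {Complex (-20) (-20), Complex 60 (-20)}"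
    by (rule collinear_3_imp_in_affine_hull) simp
  then obtain u v :: real where "u + v = 1" "60 = - 20 * u - 20 * v"
    by (auto simp: affine_hull_2 complex_eq_iff)
  then show False by linarith
qed

lemma simple_polygon_tri: "simple_polygon (convex hull set tri) tri"
  using simple_polygon_triangle[OF tri_not_collinear] by (simp add: tri_def)

text \<open>Three points contain no four-element set, and the bisector clause is empty as F - V
  is.\<close>

lemma generic_tri: "generic (set tri) (set tri)"
proof -
  have "card Q \<noteq> 4" if "Q \<subseteq> set tri" for Q
    using card_mono[OF _ that] by (simp add: set_tri)
  then show ?thesis
    using tri_not_collinear unfolding generic_def
    by (auto simp: set_tri insert_commute)
qed

lemma ball_subset_tri:
  assumes "norm x < 10" shows "x \<in> convex hull set tri"
proof -
  have "\<bar>Re x\<bar> < 10" "\<bar>Im x\<bar> < 10"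
    using assms abs_Re_le_cmod[of x] abs_Im_le_cmod[of x] by linarith+
  then show ?thesis
    unfolding set_tri convex_hull_3 mem_Collect_eq
    \<comment> \<open>Barycentric coordinates of x in the triangle with sides Re = -20, Im = -20 and
      Re + Im = 40.\<close>
    by (intro exI[of _ "(40 - Re x - Im x) / 80"] exI[of _ "(Re x + 20) / 80"]
          exI[of _ "(Im x + 20) / 80"]) (auto simp: complex_eq_iff field_simps)
qed

theorem theorem12:
  fixes n :: nat
  assumes "even n" and "n \<ge> 6"
  shows "\<exists>P vs R B. simple_polygon P vs \<and> finite R \<and> finite B \<and> R \<inter> B = {} \<and>
           card R = n div 2 \<and> card B = n div 2 \<and> R \<union> B \<subseteq> P \<and>
           general_position P vs (R \<union> B) \<and>
           (\<forall>r\<in>R. \<forall>b\<in>B. \<exists>c\<in>P.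
              gdist P c r = gdist P c b \<and>
              card ((R \<union> B) \<inter> gdisk P c (gdist P c r)) \<le> nat \<lceil>real n / 5\<rceil> + 1)"
proof -
  define N k where "N = n div 2" and "k = nat \<lceil>real n / 5\<rceil>"
  have n: "n = 2 * N" using assms(1) by (auto simp: N_def)
  have "real n / 5 \<le> real k" "real k < real n / 5 + 1"
    unfolding k_def by linarith+
  then have k: "n \<le> 5 * k" "5 * k < n + 5" by linarith+
  \<comment> \<open>If N - k exceeds k, then l = k and z = N - 2k, and 2z \<le> k amounts to n \<le>
    5k; otherwise z = 0. Also k \<le> N, so the truncated differences are genuine.\<close>
  define l z where "l = min k (N - k)" and "z = N - k - l"
  have size: "k + l + z = N" "l \<le> k" "2 * z \<le> k"
    using k assms(2) unfolding n l_def z_def by linarith+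
  define RI BI where "RI = Top ` {..<k} \<union> Bottom ` {..<l} \<union> Centre ` {..<z}"
    and "BI = East ` {..<k} \<union> West ` {..<l} \<union> Inner ` {..<z}"
  have card: "card RI = N" "card BI = N"
    unfolding RI_def BI_def size(1)[symmetric]
    by (subst card_Un_disjoint; (subst card_Un_disjoint)?; auto simp: card_image inj_on_def)+
  have fin: "finite RI" "finite BI" by (auto simp: RI_def BI_def)
  have disjoint: "RI \<inter> BI = {}" by (auto simp: RI_def BI_def)
  have disks: "place r \<noteq> place b \<and> (\<exists>c. norm c < 10 \<and> dist c (place r) = dist c (place b) \<and>
      card {s \<in> RI \<union> BI. dist c (place s) \<le> dist c (place r)} \<le> k + 1)"
    if "r \<in> RI" "b \<in> BI" for r b
  proof
    show "place r \<noteq> place b"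
      using that by (intro place_red_neq_blue) (auto simp: RI_def BI_def)
  qed (rule few_sites_in_disk[OF RI_def BI_def size(2,3) that])
  obtain q where q: "inj_on q (RI \<union> BI)" "q ` (RI \<union> BI) \<inter> set tri = {}"
      "generic (set tri) (q ` (RI \<union> BI) \<union> set tri)"
      "\<forall>s\<in>RI \<union> BI. norm (q s) < 10"
      "\<forall>r\<in>RI. \<forall>b\<in>BI. \<exists>c. norm c < 10 \<and> dist c (q r) = dist c (q b) \<and>
         card {s \<in> RI \<union> BI. dist c (q s) \<le> dist c (q r)} \<le> k + 1"
    using generic_configuration[OF finite_set generic_tri finite_UnI[OF fin] Un_upper1 Un_upper2
        norm_place disks] .
  define P where "P = convex hull set tri"
  have P: "convex P" "set tri \<subseteq> P" unfolding P_def by (auto simp: hull_inc)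
  have in_P: "x \<in> P" if "norm x < 10" for x using ball_subset_tri[OF that] by (simp add: P_def)
  have qP: "q ` RI \<union> q ` BI \<subseteq> P" using q(4) in_P by auto
  have "\<exists>c\<in>P. gdist P c (q r) = gdist P c (q b) \<and>
      card ((q ` RI \<union> q ` BI) \<inter> gdisk P c (gdist P c (q r))) \<le> k + 1"
    if rb: "r \<in> RI" "b \<in> BI" for r b
  proof -
    obtain c where c: "norm c < 10" "dist c (q r) = dist c (q b)"
        "card {s \<in> RI \<union> BI. dist c (q s) \<le> dist c (q r)} \<le> k + 1"
      using q(5) rb by blast
    have g: "gdist P c (q s) = dist c (q s)" if "s \<in> RI \<union> BI" for s
      using gdist_convex[OF P(1) in_P[OF c(1)]] that qP by blast
    have "(q ` RI \<union> q ` BI) \<inter> gdisk P c (gdist P c (q r))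
        \<subseteq> q ` {s \<in> RI \<union> BI. dist c (q s) \<le> dist c (q r)}"
      using g rb by (auto simp: gdisk_def)
    then have "card ((q ` RI \<union> q ` BI) \<inter> gdisk P c (gdist P c (q r)))
        \<le> card {s \<in> RI \<union> BI. dist c (q s) \<le> dist c (q r)}"
      using fin by (intro surj_card_le) auto
    then show ?thesis using c g rb in_P[OF c(1)] by (intro bexI[of _ c]) auto
  qed
  moreover have "general_position P tri (q ` RI \<union> q ` BI)"
    using q(2,3) qP by (intro general_position_convex[OF P]) (auto simp: image_Un)
  moreover have "simple_polygon P tri" unfolding P_def by (rule simple_polygon_tri)
  moreover have "q ` RI \<inter> q ` BI = {}"
    using q(1) disjoint by (metis image_empty inj_on_image_Int sup_ge1 sup_ge2)
  moreover have "card (q ` RI) = N" "card (q ` BI) = N"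
    using card q(1) by (simp_all add: card_image inj_on_Un)
  ultimately show ?thesis
    using fin qP unfolding N_def[symmetric] k_def[symmetric]
    by (intro exI[of _ P] exI[of _ tri] exI[of _ "q ` RI"] exI[of _ "q ` BI"]) auto
qed

end
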